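(* For every non-negative integer $n$ and every integer $s$, \[ \sum_{k = 0}^{\lfloor n/2 \rfloor } \binom n{2k}5^k F_{6k + s} = 2^{n - 1}\big(2^n F_{2n + s} + (- 1)^n F_{3n + s}\big),\qquad \sum_{k = 0}^{\lfloor n/2 \rfloor } \binom n{2k}5^k L_{6k + s} = 2^{n - 1} \big(2^n L_{2n + s} + (- 1)^n L_{3n + s}\big). \]
   Context: The Fibonacci numbers $F_j$ and Lucas numbers $L_j$ are defined for all integers $j$ by $F_0=0$, $F_1=1$, $L_0=2$, $L_1=1$, $F_j=F_{j-1}+F_{j-2}$, $L_j=L_{j-1}+L_{j-2}$, with $F_{-j}=(-1)^{j-1}F_j$ and $L_{-j}=(-1)^jL_j$. *)

theory Defs
  imports Complex_Main "HOL-Number_Theory.Fib"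
begin

fun lucas :: "nat \<Rightarrow> nat" where
  "lucas 0 = 2"
| "lucas (Suc 0) = 1"
| "lucas (Suc (Suc n)) = lucas (Suc n) + lucas n"

text \<open>Extensions to negative indices by
  \<open>F\<^bsub>-j\<^esub> = (-1)\<^bsup>j-1\<^esup> F\<^bsub>j\<^esub>\<close> and \<open>L\<^bsub>-j\<^esub> = (-1)\<^bsup>j\<^esup> L\<^bsub>j\<^esub>\<close>. In the negative branch of
  \<open>fib_int\<close> the exponent is a natural number because \<open>nat (-j) \<ge> 1\<close>.\<close>

definition fib_int :: "int \<Rightarrow> int" where
  "fib_int j = (if j \<ge> 0 then int (fib (nat j))
                else (-1) ^ (nat (-j) - 1) * int (fib (nat (-j))))"

definition lucas_int :: "int \<Rightarrow> int" where
  "lucas_int j = (if j \<ge> 0 then int (lucas (nat j))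
                  else (-1) ^ nat (-j) * int (lucas (nat (-j))))"

lemma fib_int_0: "fib_int 0 = 0" and fib_int_1: "fib_int 1 = 1"
  by (simp_all add: fib_int_def)

lemma lucas_int_0: "lucas_int 0 = 2" and lucas_int_1: "lucas_int 1 = 1"
  by (simp_all add: lucas_int_def)

lemma int_index_cases:
  fixes j :: int
  obtains (nonneg) n where "j = int n + 2" | (one) "j = 1" | (nonpos) n where "j = - int n"
proof -
  consider "j \<ge> 2" | "j = 1" | "j \<le> 0" by linarith
  then show thesis
  proof cases
    case 1
    then have "j = int (nat (j - 2)) + 2" by simp
    then show thesis by (rule nonneg)
  next
    case 2
    then show thesis by (rule one)
  next
    case 3
    then have "j = - int (nat (- j))" by simp
    then show thesis by (rule nonpos)
  qed
qed

lemma fib_int_of_nat: "fib_int (int n) = int (fib n)"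
  by (simp add: fib_int_def)

lemma lucas_int_of_nat: "lucas_int (int n) = int (lucas n)"
  by (simp add: lucas_int_def)

lemma fib_int_neg_of_nat: "fib_int (- int n) = - ((-1) ^ n * int (fib n))"
  by (cases n) (simp_all add: fib_int_def nat_add_distrib)

lemma lucas_int_neg_of_nat: "lucas_int (- int n) = (-1) ^ n * int (lucas n)"
  by (cases n) (simp_all add: lucas_int_def nat_add_distrib)

lemma fib_int_rec: "fib_int j = fib_int (j - 1) + fib_int (j - 2)"
proof (cases j rule: int_index_cases)
  case (nonneg n)
  then have "j = int (Suc (Suc n))" "j - 1 = int (Suc n)" "j - 2 = int n" by simp_all
  then show ?thesis by (simp only: fib_int_of_nat) simp
next
  case one
  then show ?thesis by (simp add: fib_int_def)
next
  case (nonpos n)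
  then have "j = - int n" "j - 1 = - int (Suc n)" "j - 2 = - int (Suc (Suc n))" by simp_all
  then show ?thesis by (simp only: fib_int_neg_of_nat) (simp add: algebra_simps)
qed

lemma lucas_int_rec: "lucas_int j = lucas_int (j - 1) + lucas_int (j - 2)"
proof (cases j rule: int_index_cases)
  case (nonneg n)
  then have "j = int (Suc (Suc n))" "j - 1 = int (Suc n)" "j - 2 = int n" by simp_all
  then show ?thesis by (simp only: lucas_int_of_nat) simp
next
  case one
  then show ?thesis by (simp add: lucas_int_def)
next
  case (nonpos n)
  then have "j = - int n" "j - 1 = - int (Suc n)" "j - 2 = - int (Suc (Suc n))" by simp_all
  then show ?thesis by (simp only: lucas_int_neg_of_nat) (simp add: algebra_simps)
qed

end

theory Submission
  imports Defs
begin

text \<open>Let \<open>G\<close> be any solution of the Fibonacci recurrence. By Pascal's rule, the sum \<open>E n s\<close> of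
  \<open>(n choose 2k) 5\<^sup>k G (6k + s)\<close> satisfies
  \<open>E (n + 2) s = 2 E (n + 1) s - E n s + 5 E n (s + 6)\<close>. The closed form satisfies the same
  recurrence, because \<open>x\<^sup>2 = x + 1\<close> implies that \<open>4x\<^sup>2\<close> and \<open>-2x\<^sup>3\<close> are the two roots of
  \<open>y\<^sup>2 = 2y - 1 + 5x\<^sup>6\<close>.\<close>

text \<open>Pascal's rule twice, with the lower index \<open>Suc m\<close> eliminated so that only
  indices of one parity remain.\<close>

lemma choose_Suc_Suc_Suc_Suc:
  "real (Suc (Suc n) choose Suc (Suc m)) =
    2 * real (Suc n choose Suc (Suc m)) - real (n choose Suc (Suc m)) + real (n choose m)"
  by simp

text \<open>The bound \<open>N\<close> is independent of \<open>n\<close>: splitting off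
  \<open>k = 0\<close> and reindexing lowers it by one, so the identity is exact for truncated sums.
  The split-off terms agree since \<open>G s = 2 * G s - G s\<close>.\<close>

lemma even_binomial_sum_rec:
  fixes G :: "int \<Rightarrow> real"
  defines "E \<equiv> \<lambda>N n s. \<Sum>k\<le>N. real (n choose (2 * k)) * 5 ^ k * G (6 * int k + s)"
  shows "E (Suc N) (Suc (Suc n)) s = 2 * E (Suc N) (Suc n) s - E (Suc N) n s + 5 * E N n (s + 6)"
proof -
  have shift: "E (Suc N) m s =
      G s + (\<Sum>k\<le>N. real (m choose Suc (Suc (2 * k))) * 5 ^ Suc k * G (6 * int k + (s + 6)))" for m
    unfolding E_def by (subst sum.atMost_Suc_shift) (simp add: algebra_simps)
  have last: "5 * E N n (s + 6) =
      (\<Sum>k\<le>N. real (n choose (2 * k)) * 5 ^ Suc k * G (6 * int k + (s + 6)))"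
    unfolding E_def by (simp add: sum_distrib_left mult_ac)
  show ?thesis
    unfolding shift last choose_Suc_Suc_Suc_Suc
    by (simp add: algebra_simps sum.distrib sum_subtractf sum_distrib_left)
qed

lemma even_binomial_sum_fibonacci_rec:
  fixes G :: "int \<Rightarrow> real"
  assumes rec: "\<And>j. G j = G (j - 1) + G (j - 2)" and "n \<le> N"
  shows "2 * (\<Sum>k\<le>N. real (n choose (2 * k)) * 5 ^ k * G (6 * int k + s)) =
    4 ^ n * G (2 * int n + s) + (- 2) ^ n * G (3 * int n + s)"
proof -
  \<comment> \<open>Every value needed below is written in the basis \<open>G t\<close>,
    \<open>G (t + 1)\<close>; the coefficients are Fibonacci numbers.\<close>
  have r: "G (t + 2) = G (t + 1) + G t" "G (t + 3) = 2 * G (t + 1) + G t"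
      "G (t + 4) = 3 * G (t + 1) + 2 * G t" "G (t + 6) = 8 * G (t + 1) + 5 * G t" for t
    using rec[of "t + 2"] rec[of "t + 3"] rec[of "t + 4"] rec[of "t + 5"] rec[of "t + 6"] by (simp_all add: algebra_simps)
  show ?thesis
    using \<open>n \<le> N\<close>
  proof (induction n arbitrary: N s rule: induct_nat_012)
    case 0
    have "(\<Sum>k\<le>N. real (0 choose (2 * k)) * 5 ^ k * G (6 * int k + s)) = (\<Sum>k\<in>{0::nat}. G s)"
      by (rule sum.mono_neutral_cong_right) auto
    then show ?case by simp
  next
    case 1
    have "(\<Sum>k\<le>N. real (Suc 0 choose (2 * k)) * 5 ^ k * G (6 * int k + s)) = (\<Sum>k\<in>{0::nat}. G s)"
      by (rule sum.mono_neutral_cong_right) (auto simp: binomial_eq_0)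
    \<comment> \<open>What remains is
      \<open>2 * G s = 4 * G (s + 2) - 2 * G (s + 3)\<close>.\<close>
    then show ?case using r[of s] by (simp add: add.commute)
  next
    case (ge2 n)
    obtain M where N: "N = Suc M" and "n \<le> M"
      using ge2.prems by (cases N) auto
    define a b where "a = 2 * int n + s" and "b = 3 * int n + s"
    \<comment> \<open>The second instance has the smaller bound \<open>M\<close> and the offset
      \<open>s + 6\<close>, hence the induction over arbitrary \<open>N\<close> and
      \<open>s\<close>.\<close>
    have IH: "2 * (\<Sum>k\<le>N. real (n choose (2 * k)) * 5 ^ k * G (6 * int k + s)) =
        4 ^ n * G a + (- 2) ^ n * G b"
      "2 * (\<Sum>k\<le>M. real (n choose (2 * k)) * 5 ^ k * G (6 * int k + (s + 6))) =
        4 ^ n * G (a + 6) + (- 2) ^ n * G (b + 6)"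
      "2 * (\<Sum>k\<le>N. real (Suc n choose (2 * k)) * 5 ^ k * G (6 * int k + s)) =
        4 ^ Suc n * G (a + 2) + (- 2) ^ Suc n * G (b + 3)"
      using ge2.IH(1)[of N s] ge2.IH(1)[of M "s + 6"] ge2.IH(2)[of N s] ge2.prems \<open>n \<le> M\<close>
      unfolding a_def b_def by (simp_all add: algebra_simps)
    have "2 * (\<Sum>k\<le>N. real (Suc (Suc n) choose (2 * k)) * 5 ^ k * G (6 * int k + s)) =
        2 * (4 ^ Suc n * G (a + 2) + (- 2) ^ Suc n * G (b + 3)) - (4 ^ n * G a + (- 2) ^ n * G b)
        + 5 * (4 ^ n * G (a + 6) + (- 2) ^ n * G (b + 6))"
      unfolding IH[symmetric] unfolding N even_binomial_sum_rec by (simp only: algebra_simps)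
    \<comment> \<open>The two powers separate:
      \<open>8 * G (a + 2) - G a + 5 * G (a + 6) = 16 * G (a + 4)\<close> and
      \<open>- 4 * G (b + 3) - G b + 5 * G (b + 6) = 4 * G (b + 6)\<close>.\<close>
    also have "\<dots> = 4 ^ Suc (Suc n) * G (a + 4) + (- 2) ^ Suc (Suc n) * G (b + 6)"
      unfolding r by (simp add: algebra_simps)
    also have "\<dots> = 4 ^ Suc (Suc n) * G (2 * int (Suc (Suc n)) + s)
        + (- 2) ^ Suc (Suc n) * G (3 * int (Suc (Suc n)) + s)"
      unfolding a_def b_def by (simp add: algebra_simps)
    finally show ?case .
  qed
qed

lemma even_binomial_sum_fibonacci_rec_half:
  fixes G :: "int \<Rightarrow> real"
  assumes rec: "\<And>j. G j = G (j - 1) + G (j - 2)"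
  shows "(\<Sum>k = 0..n div 2. real (n choose (2 * k)) * 5 ^ k * G (6 * int k + s)) =
    2 powi (int n - 1) * (2 ^ n * G (2 * int n + s) + (- 1) ^ n * G (3 * int n + s))"
proof -
  have "(\<Sum>k = 0..n div 2. real (n choose (2 * k)) * 5 ^ k * G (6 * int k + s)) =
      (\<Sum>k\<le>n. real (n choose (2 * k)) * 5 ^ k * G (6 * int k + s))"
    \<comment> \<open>For \<open>k > n div 2\<close> the binomial coefficient vanishes, as
      \<open>2 * k > n\<close>.\<close>
    by (rule sum.mono_neutral_left) (auto simp: binomial_eq_0)
  also have "\<dots> = (4 ^ n * G (2 * int n + s) + (- 2) ^ n * G (3 * int n + s)) / 2"
    using even_binomial_sum_fibonacci_rec[OF rec order_refl, of n s] by simp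
  also have "\<dots> = 2 ^ n / 2 * (2 ^ n * G (2 * int n + s) + (- 1) ^ n * G (3 * int n + s))"
    by (simp add: power_mult_distrib[symmetric] distrib_left mult.assoc[symmetric] add_divide_distrib)
  \<comment> \<open>An integer exponent is used because it is -1 at \<open>n = 0\<close>.\<close>
  also have "2 ^ n / 2 = (2 :: real) powi (int n - 1)"
    by (simp add: power_int_diff)
  finally show ?thesis .
qed

theorem theorem8:
  fixes n :: nat and s :: int
  shows "((\<Sum>k = 0..n div 2. real (n choose (2 * k)) * 5 ^ k * real_of_int (fib_int (6 * int k + s)))
      = 2 powi (int n - 1) *
          (2 ^ n * real_of_int (fib_int (2 * int n + s))
            + (- 1) ^ n * real_of_int (fib_int (3 * int n + s))))
    \<and> ((\<Sum>k = 0..n div 2. real (n choose (2 * k)) * 5 ^ k * real_of_int (lucas_int (6 * int k + s)))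
      = 2 powi (int n - 1) *
          (2 ^ n * real_of_int (lucas_int (2 * int n + s))
            + (- 1) ^ n * real_of_int (lucas_int (3 * int n + s))))"
proof -
  have "real_of_int (fib_int j) = real_of_int (fib_int (j - 1)) + real_of_int (fib_int (j - 2))"
    and "real_of_int (lucas_int j) = real_of_int (lucas_int (j - 1)) + real_of_int (lucas_int (j - 2))"
    for j
    by (simp_all only: fib_int_rec[of j] lucas_int_rec[of j] of_int_add)
  then show ?thesis
    by (intro conjI even_binomial_sum_fibonacci_rec_half)
qed

end
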